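(* Let $0\le\alpha<1$ and put $$\rho_\alpha=\frac{2-\alpha-\sqrt{\alpha^2-2\alpha+3}}{1-2\alpha}\ \text{ if }\alpha\ne\tfrac12,\qquad \rho_{1/2}=\tfrac13 .$$ Let $F\in CST_{Lh}(\alpha)$. Then for every $0<\rho\le\rho_\alpha$, $F$ maps the disk $|z|<\rho$ onto a starlike domain. Moreover, the upper bound $\rho_\alpha$ is best possible for all $a\in B$ with $a(0)=0$: for each such $a$, $\rho_\alpha$ cannot be replaced by a larger number valid for all $F=fR\in CST_{Lh}(\alpha)$ with $f$ and $R$ logharmonic with respect to $a$.
   Context: Let $U=\{z\in\mathbb{C}:|z|<1\}$, let $H(U)$ be the space of analytic functions on $U$, and let $B$ be the set of $a\in H(U)$ with $|a(z)|<1$ in $U$. A logharmonic mapping on $U$ with respect to $a\in B$ is a solution $f$ of $$\frac{\overline{f_{\overline z}}}{\overline f}=a\,\frac{f_z}{f}.$$ For $0\le\alpha<1$, $ST_{Lh}(\alpha)$ (starlike logharmonic mappings of order $\alpha$) is the set of all univalent logharmonic mappings on $U$ (with respect to some $a\in B$) of the form $f(z)=zh(z)\overline{g(z)}$, where $h,g\in H(U)$ are nonvanishing, $g(0)=1$, such that $\operatorname{Re}\frac{zf_z-\overline z f_{\overline z}}{f}>\alpha$ for all $z\in U$. (The form $f=zh\overline g$ forces $a(0)=0$.) $P_{Lh}$ is the set of all logharmonic mappings $R=H\overline G$ on $U$ with $H,G\in H(U)$, $H(0)=G(0)=1$ and $\operatorname{Re}R(z)>0$ for all $z\in U$. $CST_{Lh}(\alpha)$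 (close to starlike logharmonic mappings of order $\alpha$) is the set of all $F=fR$ with $f\in ST_{Lh}(\alpha)$ logharmonic with respect to some $a\in B$ and $R\in P_{Lh}$ logharmonic with respect to the same $a$. "$F$ maps $|z|<\rho$ onto a starlike domain" is meant in the sense of the radius of univalence and starlikeness: $F$ is univalent on $|z|<\rho$, its image is starlike with respect to the origin, and $\operatorname{Re}\frac{zF_z-\overline zF_{\overline z}}{F}>0$ for $0<|z|<\rho$. *)

theory Defs
  imports "HOL-Complex_Analysis.Complex_Analysis"
begin

text \<open>
  Functions on the unit disk are total functions of type complex to complex; only their
  values on the disk matter.
\<close>

abbreviation unit_disk :: "complex set" where
  "unit_disk \<equiv> ball 0 1"

definition dilatations :: "(complex \<Rightarrow> complex) set" where
  "dilatations = {a. a holomorphic_on unit_disk \<and> (\<forall>z\<in>unit_disk. norm (a z) < 1)}"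

text \<open>
  The Wirtinger derivatives \<open>f\<^sub>z = (f\<^sub>x - i f\<^sub>y) / 2\<close> and its conjugate counterpart
  \<open>(f\<^sub>x + i f\<^sub>y) / 2\<close>: the partial derivatives are the values of the real
  Frechet derivative in the directions \<open>1\<close> and \<open>\<i>\<close>.
\<close>

definition wirtinger :: "(complex \<Rightarrow> complex) \<Rightarrow> complex \<Rightarrow> complex" where
  "wirtinger f z =
     (frechet_derivative f (at z) 1 - \<i> * frechet_derivative f (at z) \<i>) / 2"

definition wirtinger_bar :: "(complex \<Rightarrow> complex) \<Rightarrow> complex \<Rightarrow> complex" where
  "wirtinger_bar f z =
     (frechet_derivative f (at z) 1 + \<i> * frechet_derivative f (at z) \<i>) / 2"

text \<open>The equation divides by \<open>f\<close>, so it is imposed where \<open>f\<close> does not vanish.\<close>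

definition logharmonic :: "(complex \<Rightarrow> complex) \<Rightarrow> (complex \<Rightarrow> complex) \<Rightarrow> bool" where
  "logharmonic a f \<longleftrightarrow>
     (\<forall>z\<in>unit_disk. f differentiable (at z)) \<and>
     (\<forall>z\<in>unit_disk. f z \<noteq> 0 \<longrightarrow>
        cnj (wirtinger_bar f z) / cnj (f z) = a z * (wirtinger f z / f z))"

definition starlike_quotient :: "(complex \<Rightarrow> complex) \<Rightarrow> complex \<Rightarrow> complex" where
  "starlike_quotient f z = (z * wirtinger f z - cnj z * wirtinger_bar f z) / f z"

text \<open>
  For \<open>f z = z * h z * cnj (g z)\<close> the quotient is of the form \<open>0 / 0\<close> at the origin, with
  removable value \<open>1\<close>; since \<open>\<alpha> < 1\<close> the origin imposes no condition and is left out.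
\<close>

definition ST_Lh :: "real \<Rightarrow> (complex \<Rightarrow> complex) set" where
  "ST_Lh \<alpha> = {f.
     (\<exists>a\<in>dilatations. logharmonic a f) \<and>
     inj_on f unit_disk \<and>
     (\<exists>h g. h holomorphic_on unit_disk \<and> g holomorphic_on unit_disk \<and>
        (\<forall>z\<in>unit_disk. h z \<noteq> 0 \<and> g z \<noteq> 0) \<and> g 0 = 1 \<and>
        (\<forall>z\<in>unit_disk. f z = z * h z * cnj (g z))) \<and>
     (\<forall>z\<in>unit_disk - {0}. Re (starlike_quotient f z) > \<alpha>)}"

definition P_Lh :: "(complex \<Rightarrow> complex) set" where
  "P_Lh = {R.
     (\<exists>a\<in>dilatations. logharmonic a R) \<and>
     (\<exists>H G. H holomorphic_on unit_disk \<and> G holomorphic_on unit_disk \<and>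
        H 0 = 1 \<and> G 0 = 1 \<and>
        (\<forall>z\<in>unit_disk. R z = H z * cnj (G z))) \<and>
     (\<forall>z\<in>unit_disk. Re (R z) > 0)}"

definition CST_Lh_wrt :: "real \<Rightarrow> (complex \<Rightarrow> complex) \<Rightarrow> (complex \<Rightarrow> complex) set" where
  "CST_Lh_wrt \<alpha> a = {F. \<exists>f\<in>ST_Lh \<alpha>. \<exists>R\<in>P_Lh.
     logharmonic a f \<and> logharmonic a R \<and> (\<forall>z\<in>unit_disk. F z = f z * R z)}"

definition CST_Lh :: "real \<Rightarrow> (complex \<Rightarrow> complex) set" where
  "CST_Lh \<alpha> = (\<Union>a\<in>dilatations. CST_Lh_wrt \<alpha> a)"

text \<open>The library predicate \<open>starlike\<close> leaves the centre unspecified; here it is the origin.\<close>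

definition starlike_wrt_origin :: "complex set \<Rightarrow> bool" where
  "starlike_wrt_origin S \<longleftrightarrow> 0 \<in> S \<and> (\<forall>w\<in>S. closed_segment 0 w \<subseteq> S)"

definition maps_disk_onto_starlike :: "(complex \<Rightarrow> complex) \<Rightarrow> real \<Rightarrow> bool" where
  "maps_disk_onto_starlike F \<rho> \<longleftrightarrow>
     inj_on F (ball 0 \<rho>) \<and>
     starlike_wrt_origin (F ` ball 0 \<rho>) \<and>
     (\<forall>z\<in>ball 0 \<rho> - {0}. Re (starlike_quotient F z) > 0)"

definition starlike_radius :: "real \<Rightarrow> real" where
  "starlike_radius \<alpha> =
     (if \<alpha> = 1 / 2 then 1 / 3
      else (2 - \<alpha> - sqrt (\<alpha>\<^sup>2 - 2 * \<alpha> + 3)) / (1 - 2 * \<alpha>))"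

end

theory Submission imports Defs begin

text \<open>
  Write \<open>F = z (h H) \<cdot> cnj (g G)\<close>. The starlikeness quotient of \<open>F\<close> has the same real part as
  \<open>p + z q' / q\<close>, where \<open>p = z \<phi>' / \<phi>\<close> with \<open>\<phi> = z h / g\<close> satisfies \<open>Re p > \<alpha>\<close> and \<open>q = H / G\<close>
  satisfies \<open>Re q > 0\<close>. Schwarz's lemma bounds it below by
  \<open>(1 - (4 - 2\<alpha>) r + (1 - 2\<alpha>) r\<^sup>2) / (1 - r\<^sup>2)\<close>, whose numerator first vanishes at the radius.

  Positivity of the quotient means that \<open>arg F\<close> increases strictly along circles, so each level
  set of \<open>arg F\<close> is a curve meeting every circle once; since the dilatation is bounded by \<open>1\<close>,
  \<open>|F|\<close> increases strictly along that curve. This gives univalence and starlikeness.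

  Equality holds at \<open>z = - r\<close> for \<open>p = (1 + (1 - 2\<alpha>) z) / (1 - z)\<close> and \<open>q = (1 + z) / (1 - z)\<close>, and
  both can be realised for any prescribed dilatation vanishing at \<open>0\<close>.
\<close>

section \<open>Wirtinger derivatives of products of a holomorphic and an antiholomorphic
  factor\<close>

text \<open>Conjugating only the second factor separates the derivatives: \<open>u\<close> carries
  all of the \<open>z\<close>-derivative and \<open>v\<close> all of its conjugate counterpart.
  Agreement of \<open>F\<close> with the product near \<open>z\<close> is enough, which suits total
  functions whose values outside the disk are arbitrary.\<close>

lemma wirtinger_mult_cnj:
  assumes S: "open S" "z \<in> S" and F: "\<And>w. w \<in> S \<Longrightarrow> F w = u w * cnj (v w)"
    and u: "(u has_field_derivative u') (at z)" and v: "(v has_field_derivative v') (at z)"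
  shows "F differentiable (at z)" "wirtinger F z = u' * cnj (v z)"
    "wirtinger_bar F z = u z * cnj v'"
proof -
  have "((\<lambda>w. u w * cnj (v w)) has_derivative
      (\<lambda>t. u z * cnj (v' * t) + u' * t * cnj (v z))) (at z)"
    by (intro has_derivative_mult has_derivative_cnj)
      (use u v in \<open>simp_all add: has_field_derivative_def\<close>)
  then have d: "(F has_derivative (\<lambda>t. u z * cnj (v' * t) + u' * t * cnj (v z))) (at z)"
    using S by (rule has_derivative_transform_within_open) (simp add: F)
  then show "F differentiable (at z)"
    by (auto simp: differentiable_def)
  have fd: "frechet_derivative F (at z) = (\<lambda>t. u z * cnj (v' * t) + u' * t * cnj (v z))"
    using frechet_derivative_at[OF d] by simp
  show "wirtinger F z = u' * cnj (v z)" "wirtinger_bar F z = u z * cnj v'"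
    unfolding wirtinger_def wirtinger_bar_def fd by (simp_all add: algebra_simps)
qed

lemma starlike_quotient_mult_cnj:
  assumes "open S" "z \<in> S" "\<And>w. w \<in> S \<Longrightarrow> F w = u w * cnj (v w)"
    and "(u has_field_derivative u') (at z)" "(v has_field_derivative v') (at z)"
    and "u z \<noteq> 0" "v z \<noteq> 0"
  shows "starlike_quotient F z = z * u' / u z - cnj (z * v' / v z)"
proof -
  have "wirtinger F z = u' * cnj (v z)"
    using assms(1-5) by (rule wirtinger_mult_cnj)
  moreover have "wirtinger_bar F z = u z * cnj v'"
    using assms(1-5) by (rule wirtinger_mult_cnj)
  ultimately show ?thesis
    using assms(2,3,6,7) by (simp add: starlike_quotient_def field_simps)
qed

section \<open>Univalence and starlikeness from a positive quotient\<close>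

text \<open>The substitution \<open>z = exp s\<close> replaces the punctured disk by the half-plane
  \<open>H\<close>, on which \<open>arg F\<close> has a single-valued branch. Hypothesis
  \<open>eq\<close> is the logharmonic equation written for the logarithms of the factors and
  cleared of the denominator \<open>z\<close>.\<close>

lemma starlike_logharmonic_exp:
  fixes l1 l2 a F :: "complex \<Rightarrow> complex"
  assumes \<rho>: "0 < \<rho>"
    and hol: "l1 holomorphic_on ball 0 \<rho>" "l2 holomorphic_on ball 0 \<rho>"
    and F: "\<And>z. z \<in> ball 0 \<rho> \<Longrightarrow> F z = z * exp (l1 z) * cnj (exp (l2 z))"
    and eq: "\<And>z. z \<in> ball 0 \<rho> - {0} \<Longrightarrow> z * deriv l2 z = a z * (1 + z * deriv l1 z)"
    and a: "\<And>z. z \<in> ball 0 \<rho> - {0} \<Longrightarrow> norm (a z) < 1"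
    and pos: "\<And>z. z \<in> ball 0 \<rho> - {0} \<Longrightarrow> Re (1 + z * deriv l1 z - z * deriv l2 z) > 0"
  shows "inj_on F (ball 0 \<rho>)" "starlike_wrt_origin (F ` ball 0 \<rho>)"
proof -
  define H where "H = {s. Re s < ln \<rho>}"
  have expH: "exp s \<in> ball 0 \<rho> - {0}" if "s \<in> H" for s
    using that \<rho> exp_less_cancel_iff[of "Re s" "ln \<rho>"] by (simp add: H_def)
  have lnH: "Ln z \<in> H" if "z \<in> ball 0 \<rho> - {0}" for z
    using that \<rho> by (simp add: H_def)
  have openH: "open H"
    unfolding H_def by (rule open_halfspace_Re_lt)
  \<comment> \<open>Since \<open>F (exp s) = exp (s + l1 (exp s) + cnj (l2 (exp s)))\<close> and
    conjugation changes the sign of imaginary parts only, the holomorphic functions \<open>L\<close>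
    and \<open>S\<close> satisfy \<open>Im L = arg F\<close> and
    \<open>Re S = ln |F|\<close>.\<close>
  define L where "L s = s + l1 (exp s) - l2 (exp s)" for s
  define S where "S s = s + l1 (exp s) + l2 (exp s)" for s
  define L' where "L' s = 1 + exp s * deriv l1 (exp s) - exp s * deriv l2 (exp s)" for s
  define S' where "S' s = 1 + exp s * deriv l1 (exp s) + exp s * deriv l2 (exp s)" for s
  have l: "((\<lambda>s. l1 (exp s)) has_field_derivative deriv l1 (exp s) * exp s) (at s)"
    "((\<lambda>s. l2 (exp s)) has_field_derivative deriv l2 (exp s) * exp s) (at s)" if "s \<in> H" for s
    using expH[OF that] hol
    by (auto intro!: DERIV_chain2[OF _ DERIV_exp] holomorphic_derivI[of _ "ball 0 \<rho>"])
  have dL: "(L has_field_derivative L' s) (at s)" if "s \<in> H" for s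
    unfolding L_def L'_def by (rule derivative_eq_intros l[OF that] refl | simp)+
  have dS: "(S has_field_derivative S' s) (at s)" if "s \<in> H" for s
    unfolding S_def S'_def by (rule derivative_eq_intros l[OF that] refl | simp)+
  have Fexp: "F (exp s) = exp (Complex (Re (S s)) (Im (L s)))" if "s \<in> H" for s
  proof -
    have "F (exp s) = exp (s + l1 (exp s) + cnj (l2 (exp s)))"
      using F[of "exp s"] expH[OF that] by (simp add: exp_add exp_cnj)
    also have "s + l1 (exp s) + cnj (l2 (exp s)) = Complex (Re (S s)) (Im (L s))"
      by (simp add: complex_eq_iff S_def L_def)
    finally show ?thesis .
  qed
  have L'pos: "Re (L' s) > 0" if "s \<in> H" for s
    using pos[OF expH[OF that]] by (simp add: L'_def)
  \<comment> \<open>By \<open>eq\<close> both derivatives are multiples of the same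
    \<open>M\<close>, namely \<open>L' = (1 - b) M\<close> and \<open>S' = (1 + b) M\<close>. The
    real part is therefore \<open>(1 - |b|^2) |M|^2\<close>, and this is where the bound on the
    dilatation enters.\<close>
  have S'L': "Re (S' s * cnj (L' s)) > 0" if "s \<in> H" for s
  proof -
    define M b where "M = 1 + exp s * deriv l1 (exp s)" and "b = a (exp s)"
    have LM: "L' s = (1 - b) * M" and SM: "S' s = (1 + b) * M"
      using eq[OF expH[OF that]] by (simp_all add: L'_def S'_def M_def b_def algebra_simps)
    have "M \<noteq> 0" using L'pos[OF that] LM by auto
    have "norm b < 1" using a[OF expH[OF that]] by (simp add: b_def)
    have "S' s * cnj (L' s) = ((1 + b) * cnj (1 - b)) * (M * cnj M)"
      by (simp add: LM SM)
    then have "Re (S' s * cnj (L' s)) = Re ((1 + b) * cnj (1 - b)) * (norm M)\<^sup>2"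
      by (simp add: complex_norm_square[symmetric] del: complex_cnj_diff)
    moreover have "Re ((1 + b) * cnj (1 - b)) = 1 - (norm b)\<^sup>2"
      unfolding cmod_power2 by (simp add: algebra_simps power2_eq_square)
    moreover have "(norm b)\<^sup>2 < 1"
      using \<open>norm b < 1\<close> by (simp add: power_less_one_iff)
    ultimately show ?thesis
      using \<open>M \<noteq> 0\<close> by simp
  qed
  \<comment> \<open>In the coordinate \<open>z = exp s\<close>, \<open>T\<close> maps the half-plane \<open>H\<close> onto itself and straightens the level
    sets of \<open>arg F = Im L\<close> into horizontal lines, along which \<open>ln |F| = Re S\<close> is then differentiated.\<close>
  define T where "T s = Complex (Re s) (Im (L s))" for s
  \<comment> \<open>Translations by multiples of \<open>2 * pi * \<i>\<close> account for the choice
    of logarithm. They serve twice: for the surjectivity of \<open>T\<close> and for comparing two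
    points with equal values of \<open>F\<close>.\<close>
  have per: "exp (s + of_int n * (2 * pi * \<i>)) = exp s" "s + of_int n * (2 * pi * \<i>) \<in> H"
      "Im (L (s + of_int n * (2 * pi * \<i>))) = Im (L s) + 2 * pi * n"
      "Re (S (s + of_int n * (2 * pi * \<i>))) = Re (S s)" if "s \<in> H" for s and n :: int
  proof -
    show *: "exp (s + of_int n * (2 * pi * \<i>)) = exp s"
      unfolding exp_eq by auto
    show "s + of_int n * (2 * pi * \<i>) \<in> H"
      using that by (simp add: H_def)
    show "Im (L (s + of_int n * (2 * pi * \<i>))) = Im (L s) + 2 * pi * n"
      unfolding L_def * by simp
    show "Re (S (s + of_int n * (2 * pi * \<i>))) = Re (S s)"
      unfolding S_def * by simp
  qed
  \<comment> \<open>Moving vertically multiplies the derivative of \<open>L\<close> by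
    \<open>\<i>\<close>, and \<open>Im (\<i> * L') = Re L'\<close>.\<close>
  have dIm: "((\<lambda>y. Im (L (Complex x y))) has_real_derivative Re (L' (Complex x y))) (at y)"
    if "x < ln \<rho>" for x y
  proof -
    have d: "((\<lambda>y. Complex x y) has_vector_derivative \<i>) (at y)"
      unfolding Complex_eq by (rule derivative_eq_intros refl | simp)+
    have "(L has_field_derivative L' (Complex x y)) (at (Complex x y))"
      using that by (intro dL) (simp add: H_def)
    from field_vector_diff_chain_at[OF d this]
    have "((\<lambda>y. L (Complex x y)) has_vector_derivative \<i> * L' (Complex x y)) (at y)"
      by (simp add: o_def)
    then have "((\<lambda>y. Im (L (Complex x y))) has_vector_derivative Im (\<i> * L' (Complex x y))) (at y)"
      by (rule bounded_linear.has_vector_derivative[OF bounded_linear_Im])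
    then show ?thesis
      by (simp add: has_real_derivative_iff_has_vector_derivative)
  qed
  have mono: "Im (L (Complex x y1)) < Im (L (Complex x y2))" if "x < ln \<rho>" "y1 < y2" for x y1 y2
    using that(2) by (rule DERIV_pos_imp_increasing) (use that(1) dIm L'pos in \<open>force simp: H_def\<close>)
  have injT: "inj_on T H"
  proof (rule inj_onI)
    fix s t assume st: "s \<in> H" "t \<in> H" "T s = T t"
    then have "Re s = Re t" "Im (L s) = Im (L t)" by (auto simp: T_def)
    moreover have "Im s = Im t"
    proof (rule ccontr)
      assume "Im s \<noteq> Im t"
      then have "Im (L (Complex (Re s) (Im s))) \<noteq> Im (L (Complex (Re s) (Im t)))"
        using mono[of "Re s" "Im s" "Im t"] mono[of "Re s" "Im t" "Im s"] st(1)
        by (cases "Im s < Im t") (auto simp: H_def)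
      with \<open>Re s = Re t\<close> \<open>Im (L s) = Im (L t)\<close> show False
        by (metis complex.collapse)
    qed
    ultimately show "s = t" by (simp add: complex_eq_iff)
  qed
  \<comment> \<open>On a vertical line \<open>Im L\<close> is continuous and grows by
    \<open>2 * pi * n\<close> over a step of \<open>2 * pi * n\<close>. A large \<open>n\<close>
    makes its values at the heights \<open>- 2 * pi * n\<close> and \<open>2 * pi * n\<close>
    straddle \<open>Im w\<close>.\<close>
  have surjT: "\<exists>s\<in>H. T s = w" if w: "w \<in> H" for w
  proof -
    define x where "x = Re w"
    define c where "c = Im (L (of_real x))"
    have x: "x < ln \<rho>" "of_real x \<in> H" using w by (auto simp: x_def H_def)
    obtain n :: nat where n: "\<bar>Im w - c\<bar> / (2 * pi) < n"
      using reals_Archimedean2 by blast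
    then have n': "\<bar>Im w - c\<bar> < 2 * pi * n"
      by (simp add: field_simps)
    have ends: "Im (L (Complex x (2 * pi * k))) = c + 2 * pi * k" for k :: int
    proof -
      have "Complex x (2 * pi * k) = of_real x + of_int k * (2 * pi * \<i>)"
        by (simp add: complex_eq_iff)
      then show ?thesis using per(3)[OF x(2), of k] by (simp add: c_def)
    qed
    have "\<exists>y. - (2 * pi * n) \<le> y \<and> y \<le> 2 * pi * n \<and> Im (L (Complex x y)) = Im w"
      by (rule IVT) (use ends[of "- int n"] ends[of "int n"] n' DERIV_isCont[OF dIm[OF x(1)]] in auto)
    then obtain y where "Im (L (Complex x y)) = Im w" by blast
    then have "T (Complex x y) = w" "Complex x y \<in> H"
      using x by (auto simp: T_def complex_eq_iff x_def H_def)
    then show ?thesis by blast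
  qed
  define g where "g = inv_into H T"
  have gT: "g (T s) = s" if "s \<in> H" for s
    using that injT by (simp add: g_def)
  have Tg: "T (g w) = w" "g w \<in> H" if "w \<in> H" for w
    using surjT[OF that] gT by auto
  have Reg: "Re (g w) = Re w" "Im (L (g w)) = Im w" if "w \<in> H" for w
    using Tg(1)[OF that] by (auto simp: T_def complex_eq_iff)
  have dT: "(T has_derivative (\<lambda>t. Complex (Re t) (Im (L' s * t)))) (at s)" if "s \<in> H" for s
    using dL[OF that] unfolding T_def Complex_eq has_field_derivative_def
    by (auto intro!: derivative_eq_intros)
  \<comment> \<open>The derivative of \<open>T\<close> sends \<open>t\<close> to real part
    \<open>Re t\<close> and imaginary part \<open>Re L' * Im t + Im L' * Re t\<close>; solving for
    \<open>Im t\<close> gives the inverse, with the positive denominator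
    \<open>Re L'\<close>.\<close>
  have dg: "(g has_derivative (\<lambda>t. Complex (Re t) ((Im t - Im (L' (g w)) * Re t) / Re (L' (g w))))) (at w)"
    if "w \<in> H" for w
  proof (rule has_derivative_inverse_strong_x[OF openH _ _ gT dT])
    show "g w \<in> H" "T (g w) = w" "g w \<in> H" using Tg that by auto
    show "continuous_on H T"
      using dT has_derivative_continuous by (blast intro: continuous_at_imp_continuous_on)
    show "(\<lambda>t. Complex (Re t) (Im (L' (g w) * t))) \<circ>
        (\<lambda>t. Complex (Re t) ((Im t - Im (L' (g w)) * Re t) / Re (L' (g w)))) = id"
      using L'pos[of "g w"] Tg(2)[OF that] by (auto simp: fun_eq_iff complex_eq_iff)
  qed
  \<comment> \<open>The image of the horizontal direction under the derivative of \<open>g\<close>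
    is \<open>cnj L' / Re L'\<close>, so \<open>ln |F|\<close> has derivative
    \<open>Re (S' * cnj L') / Re L'\<close> along a level curve of \<open>arg F\<close>.\<close>
  have du: "\<exists>D>0. ((\<lambda>x. Re (S (g (Complex x \<theta>)))) has_real_derivative D) (at x)"
    if "x < ln \<rho>" for x \<theta>
  proof -
    let ?w = "Complex x \<theta>"
    have w: "?w \<in> H" using that by (simp add: H_def)
    let ?s = "g ?w"
    have s: "?s \<in> H" using Tg(2)[OF w] .
    have d0: "((\<lambda>x. Complex x \<theta>) has_vector_derivative 1) (at x)"
      unfolding Complex_eq by (rule derivative_eq_intros refl | simp)+
    have "((g \<circ> (\<lambda>x. Complex x \<theta>)) has_vector_derivative Complex 1 (- Im (L' ?s) / Re (L' ?s))) (at x)"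
      using vector_derivative_diff_chain_within[OF d0 has_derivative_at_withinI[OF dg[OF w]]] by simp
    from field_vector_diff_chain_at[OF this, of S "S' ?s"] dS[OF s]
    have "((\<lambda>x. S (g (Complex x \<theta>))) has_vector_derivative Complex 1 (- Im (L' ?s) / Re (L' ?s)) * S' ?s) (at x)"
      by (simp add: o_def)
    then have "((\<lambda>x. Re (S (g (Complex x \<theta>)))) has_vector_derivative Re (Complex 1 (- Im (L' ?s) / Re (L' ?s)) * S' ?s)) (at x)"
      by (rule bounded_linear.has_vector_derivative[OF bounded_linear_Re])
    moreover have "Re (Complex 1 (- Im (L' ?s) / Re (L' ?s)) * S' ?s) = Re (S' ?s * cnj (L' ?s)) / Re (L' ?s)"
      using L'pos[OF s] by (simp add: field_simps)
    moreover have "Re (S' ?s * cnj (L' ?s)) / Re (L' ?s) > 0"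
      using S'L'[OF s] L'pos[OF s] by simp
    ultimately show ?thesis
      by (metis has_real_derivative_iff_has_vector_derivative)
  qed
  have umono: "Re (S (g (Complex x1 \<theta>))) < Re (S (g (Complex x2 \<theta>)))" if "x1 < x2" "x2 < ln \<rho>" for x1 x2 \<theta>
    using that(1)
  proof (rule DERIV_pos_imp_increasing)
    fix x assume "x \<le> x2"
    then show "\<exists>D. ((\<lambda>x. Re (S (g (Complex x \<theta>)))) has_real_derivative D) (at x) \<and> D > 0"
      using du[of x \<theta>] that(2) by auto
  qed
  have gself: "g (Complex (Re s) (Im (L s))) = s" if "s \<in> H" for s
    using gT[OF that] by (simp add: T_def)
  have F0: "F 0 = 0" using F[of 0] \<rho> by simp
  have Fnz: "F z \<noteq> 0" if "z \<in> ball 0 \<rho> - {0}" for z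
    using F[of z] that by simp
  show "inj_on F (ball 0 \<rho>)"
  proof (rule inj_onI)
    fix z1 z2 assume z: "z1 \<in> ball 0 \<rho>" "z2 \<in> ball 0 \<rho>" "F z1 = F z2"
    show "z1 = z2"
    proof (cases "z1 = 0 \<or> z2 = 0")
      case True
      then show ?thesis using Fnz z F0 by force
    next
      case False
      define s1 s2 where "s1 = Ln z1" and "s2 = Ln z2"
      have s: "s1 \<in> H" "s2 \<in> H" "exp s1 = z1" "exp s2 = z2"
        using False z lnH by (auto simp: s1_def s2_def)
      have "exp (Complex (Re (S s1)) (Im (L s1))) = exp (Complex (Re (S s2)) (Im (L s2)))"
        using z(3) Fexp[OF s(1)] Fexp[OF s(2)] s by simp
      then obtain n :: int where n: "Complex (Re (S s1)) (Im (L s1))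
          = Complex (Re (S s2)) (Im (L s2)) + (of_int (2 * n) * pi) * \<i>"
        unfolding exp_eq by blast
      \<comment> \<open>Equal values of \<open>F\<close> give equal arguments only modulo
        \<open>2 * pi\<close>. The shift makes \<open>Im L\<close> agree exactly, so that
        \<open>s1\<close> and \<open>s3\<close> lie on one level curve, where \<open>ln |F|\<close>
        is strictly increasing.\<close>
      define s3 where "s3 = s2 + of_int n * (2 * pi * \<i>)"
      have s3: "s3 \<in> H" "exp s3 = z2" "Re (S s3) = Re (S s1)" "Im (L s3) = Im (L s1)"
        using per[OF s(2), of n] n s(4) by (auto simp: s3_def complex_eq_iff)
      have "Re s1 = Re s3"
      proof (rule ccontr)
        assume "Re s1 \<noteq> Re s3"
        then show False
          using umono[of "Re s1" "Re s3" "Im (L s1)"] umono[of "Re s3" "Re s1" "Im (L s1)"]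
            gself[OF s(1)] gself[OF s3(1)] s(1) s3
          by (cases "Re s1 < Re s3") (auto simp: H_def)
      qed
      then have "s1 = s3"
        using gself[OF s(1)] gself[OF s3(1)] s3(4) by metis
      then show ?thesis using s s3 by simp
    qed
  qed
  have contF: "continuous (at 0) F"
  proof -
    have "continuous_on (ball 0 \<rho>) (\<lambda>z. z * exp (l1 z) * cnj (exp (l2 z)))"
      using hol by (intro continuous_intros holomorphic_on_imp_continuous_on)
    then have "continuous_on (ball 0 \<rho>) F"
      by (rule continuous_on_eq) (simp add: F)
    then show ?thesis
      using \<rho> by (simp add: continuous_on_eq_continuous_at)
  qed
  show "starlike_wrt_origin (F ` ball 0 \<rho>)"
    unfolding starlike_wrt_origin_def
  proof (intro conjI ballI subsetI)
    show zero: "0 \<in> F ` ball 0 \<rho>"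
      using F0 \<rho> by (metis centre_in_ball image_eqI)
    fix w v assume w: "w \<in> F ` ball 0 \<rho>" and v: "v \<in> closed_segment 0 w"
    obtain z where z: "z \<in> ball 0 \<rho>" "w = F z" using w by blast
    obtain t where t: "0 \<le> t" "t \<le> 1" "v = of_real t * F z"
      using v z by (auto simp: closed_segment_def scaleR_conv_of_real)
    show "v \<in> F ` ball 0 \<rho>"
    proof (cases "t = 0 \<or> z = 0")
      case True
      then show ?thesis using t zero F0 by auto
    next
      case False
      then have "t > 0" "z \<noteq> 0" using t by auto
      define s \<theta> where "s = Ln z" and "\<theta> = Im (L (Ln z))"
      have s: "s \<in> H" "exp s = z" using lnH z \<open>z \<noteq> 0\<close> by (auto simp: s_def)
      have "0 < t * norm (F z)" using Fnz[of z] z \<open>z \<noteq> 0\<close> \<open>t > 0\<close> by simp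
      then obtain \<delta> where \<delta>: "\<delta> > 0" "\<And>z'. dist z' 0 < \<delta> \<Longrightarrow> norm (F z') < t * norm (F z)"
        using contF F0 unfolding continuous_at_eps_delta by (metis dist_0_norm dist_commute)
      \<comment> \<open>Far enough to the left,
        \<open>|exp (g (Complex x \<theta>))| = exp x\<close> is below \<delta>, hence
        \<open>|F|\<close> is below \<open>t * |F z|\<close>. The intermediate value theorem along
        the level curve from there to \<open>z\<close> then finds a point with value
        \<open>t * F z\<close>. Subtracting 1 makes the inequalities strict.\<close>
      define x where "x = min (ln \<delta> - 1) (Re s - 1)"
      have x: "x < ln \<delta>" "x < Re s" "x < ln \<rho>" using s(1) by (auto simp: x_def H_def)
      let ?u = "\<lambda>x. Re (S (g (Complex x \<theta>)))"
      have Fg: "F (exp (g (Complex y \<theta>))) = exp (Complex (?u y) \<theta>)" "exp (g (Complex y \<theta>)) \<in> ball 0 \<rho>"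
        if "y < ln \<rho>" for y
        using Fexp[OF Tg(2), of "Complex y \<theta>"] Reg(2)[of "Complex y \<theta>"]
          expH[OF Tg(2), of "Complex y \<theta>"] that by (auto simp: H_def)
      have us: "?u (Re s) = Re (S s)" using gself[OF s(1)] by (simp add: \<theta>_def s_def)
      have Fz: "F z = exp (Complex (Re (S s)) \<theta>)"
        using Fexp[OF s(1)] s(2) by (simp add: \<theta>_def s_def)
      have "norm (exp (g (Complex x \<theta>))) < \<delta>"
        using Reg(1)[of "Complex x \<theta>"] x(1,3) \<delta>(1) exp_less_cancel_iff[of x "ln \<delta>"] by (simp add: H_def)
      then have "norm (F (exp (g (Complex x \<theta>)))) < t * norm (F z)"
        using \<delta>(2) by simp
      then have "exp (?u x) < exp (ln t + Re (S s))"
        using Fg(1)[OF x(3)] Fz \<open>t > 0\<close> by (simp add: exp_add)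
      then have lo: "?u x \<le> ln t + Re (S s)" by simp
      have hi: "ln t + Re (S s) \<le> ?u (Re s)" using us t \<open>t > 0\<close> by simp
      have "\<exists>y. x \<le> y \<and> y \<le> Re s \<and> ?u y = ln t + Re (S s)"
      proof (rule IVT[where f = ?u, OF lo hi])
        show "\<forall>y. x \<le> y \<and> y \<le> Re s \<longrightarrow> isCont ?u y"
        proof (intro allI impI)
          fix y assume "x \<le> y \<and> y \<le> Re s"
          then obtain D where "(?u has_real_derivative D) (at y)"
            using du[of y \<theta>] s(1) by (auto simp: H_def)
          then show "isCont ?u y" by (rule DERIV_isCont)
        qed
      qed (use x in simp)
      then obtain y where y: "y \<le> Re s" "?u y = ln t + Re (S s)" by blast
      then have y\<rho>: "y < ln \<rho>" using s(1) by (simp add: H_def)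
      have "F (exp (g (Complex y \<theta>))) = exp (of_real (ln t) + Complex (Re (S s)) \<theta>)"
        unfolding Fg(1)[OF y\<rho>] y(2) by (simp add: Complex_eq algebra_simps)
      also have "\<dots> = v"
        using t(3) Fz \<open>t > 0\<close> by (simp only: exp_add exp_of_real) simp
      finally show ?thesis using Fg(2)[OF y\<rho>] by (metis imageI)
    qed
  qed
qed

section \<open>Schwarz-type estimates for functions into a half-plane\<close>

text \<open>The map \<omega> composes \<open>q\<close> with the Cayley transform of the right
  half-plane that sends \<open>q 0\<close> to 0. Schwarz's lemma applies to it, and its derivative
  at 0 is \<open>deriv q 0 / (2 * Re (q 0))\<close>.\<close>

lemma Schwarz_right_half_plane:
  assumes hol: "q holomorphic_on unit_disk" and pos: "\<And>z. z \<in> unit_disk \<Longrightarrow> Re (q z) > 0"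
    and z: "z \<in> unit_disk"
  shows "norm (q z - q 0) \<le> norm z * norm (q z + cnj (q 0))"
    and "norm (deriv q 0) \<le> 2 * Re (q 0)"
proof -
  define \<omega> where "\<omega> w = (q w - q 0) / (q w + cnj (q 0))" for w
  have q0: "Re (q 0) > 0" using pos[of 0] by simp
  have nz: "q w + cnj (q 0) \<noteq> 0" if "w \<in> unit_disk" for w
    using pos[OF that] q0 by (auto simp: complex_eq_iff)
  have hol\<omega>: "\<omega> holomorphic_on ball 0 1"
    unfolding \<omega>_def using nz hol by (intro holomorphic_intros) auto
  have lt: "norm (\<omega> w) < 1" if "norm w < 1" for w
  proof -
    have "(norm (q w - q 0))\<^sup>2 + 4 * (Re (q w) * Re (q 0)) = (norm (q w + cnj (q 0)))\<^sup>2"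
      unfolding cmod_power2 by (simp add: algebra_simps power2_eq_square)
    moreover have "Re (q w) * Re (q 0) > 0" using pos[of w] q0 that by simp
    ultimately have "(norm (q w - q 0))\<^sup>2 < (norm (q w + cnj (q 0)))\<^sup>2" by linarith
    then have "norm (q w - q 0) < norm (q w + cnj (q 0))"
      by (rule power2_less_imp_less) simp
    then show ?thesis by (simp add: \<omega>_def norm_divide divide_less_eq)
  qed
  have zero: "\<omega> 0 = 0" by (simp add: \<omega>_def)
  have "norm (\<omega> z) \<le> norm z"
    using Schwarz_Lemma(1)[OF hol\<omega> zero lt] z by simp
  then show "norm (q z - q 0) \<le> norm z * norm (q z + cnj (q 0))"
    using nz[OF z] by (simp add: \<omega>_def norm_divide divide_le_eq)
  have "(q has_field_derivative deriv q 0) (at 0)"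
    using hol by (intro holomorphic_derivI[of _ "ball 0 1"]) auto
  then have "(\<omega> has_field_derivative (deriv q 0 * (q 0 + cnj (q 0))) / (q 0 + cnj (q 0))\<^sup>2) (at 0)"
    unfolding \<omega>_def using nz[of 0]
    by (auto intro!: derivative_eq_intros simp: power2_eq_square)
  then have "deriv \<omega> 0 = deriv q 0 / (q 0 + cnj (q 0))"
    using nz[of 0] by (simp add: DERIV_imp_deriv power2_eq_square)
  also have "q 0 + cnj (q 0) = of_real (2 * Re (q 0))"
    by (simp add: complex_add_cnj)
  finally have "norm (deriv q 0) / (2 * Re (q 0)) = norm (deriv \<omega> 0)"
    using q0 by (simp add: norm_divide norm_mult)
  also have "\<dots> \<le> 1" using Schwarz_Lemma(2)[OF hol\<omega> zero lt, of 0] by simp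
  finally show "norm (deriv q 0) \<le> 2 * Re (q 0)"
    using q0 by (simp add: divide_le_eq)
qed

text \<open>After rescaling to \<open>q 0 = 1\<close>, Schwarz confines \<open>q z\<close> to a disk
  symmetric about the real axis with leftmost point \<open>(1 - r) / (1 + r)\<close>. The resulting
  bound is the value at \<open>- r\<close> of
  \<open>(1 + (1 - 2 * \<alpha>) * z) / (1 - z)\<close>.\<close>

lemma Re_ge_half_plane_function:
  assumes hol: "p holomorphic_on unit_disk" and p: "\<And>z. z \<in> unit_disk \<Longrightarrow> Re (p z) > \<alpha>"
    and p0: "p 0 = 1" and z: "z \<in> unit_disk"
  shows "Re (p z) \<ge> (1 - (1 - 2 * \<alpha>) * norm z) / (1 + norm z)"
proof -
  have \<alpha>: "\<alpha> < 1" using p[of 0] p0 by simp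
  define q where "q w = (p w - of_real \<alpha>) / of_real (1 - \<alpha>)" for w
  define r x where "r = norm z" and "x = Re (q z)"
  have r: "0 \<le> r" "r < 1" using z by (auto simp: r_def)
  have "q holomorphic_on unit_disk"
    unfolding q_def using hol \<alpha> by (intro holomorphic_intros) auto
  moreover have Req: "Re (q w) = (Re (p w) - \<alpha>) / (1 - \<alpha>)" for w
    unfolding q_def by (simp del: of_real_diff)
  then have "Re (q w) > 0" if "w \<in> unit_disk" for w
    using p[OF that] \<alpha> by simp
  ultimately have "norm (q z - q 0) \<le> r * norm (q z + cnj (q 0))"
    unfolding r_def using Schwarz_right_half_plane(1) z by blast
  moreover have "q 0 = 1"
    using p0 \<alpha> by (auto simp: q_def divide_eq_1_iff)
  ultimately have "(norm (q z - 1))\<^sup>2 \<le> (r * norm (q z + 1))\<^sup>2"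
    by (intro power_mono) auto
  then have "(x - 1)\<^sup>2 + (Im (q z))\<^sup>2 \<le> r\<^sup>2 * ((x + 1)\<^sup>2 + (Im (q z))\<^sup>2)"
    unfolding power_mult_distrib cmod_power2 by (simp add: x_def)
  moreover have "r\<^sup>2 * (Im (q z))\<^sup>2 \<le> 1 * (Im (q z))\<^sup>2"
    using r by (intro mult_right_mono) (auto simp: power_le_one)
  ultimately have "(x - 1)\<^sup>2 \<le> (r * (x + 1))\<^sup>2"
    unfolding power_mult_distrib by (simp add: distrib_left)
  then have sq: "\<bar>x - 1\<bar>\<^sup>2 \<le> (r * (x + 1))\<^sup>2" by simp
  have "x > 0" using Req p[OF z] \<alpha> by (simp add: x_def)
  then have "0 \<le> r * (x + 1)" using r by simp
  with sq have "\<bar>x - 1\<bar> \<le> r * (x + 1)" by (rule power2_le_imp_le)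
  then have "1 - x \<le> r * (x + 1)" by linarith
  then have "(1 - r) / (1 + r) \<le> x"
    using r by (simp add: field_simps)
  then have "(1 - \<alpha>) * ((1 - r) / (1 + r)) \<le> (1 - \<alpha>) * x"
    using \<alpha> by (intro mult_left_mono) auto
  also have "\<dots> = Re (p z) - \<alpha>" using Req \<alpha> by (simp add: x_def)
  finally have "\<alpha> + (1 - \<alpha>) * ((1 - r) / (1 + r)) \<le> Re (p z)" by simp
  moreover have "\<alpha> + (1 - \<alpha>) * ((1 - r) / (1 + r)) = (1 - (1 - 2 * \<alpha>) * r) / (1 + r)"
    using r by (simp add: field_simps)
  ultimately show ?thesis by (simp add: r_def)
qed

text \<open>The disk automorphism \<open>M\<close> takes 0 to \<open>z\<close> and has derivative
  \<open>1 - |z|^2\<close> at 0, which transports the derivative bound from the origin to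
  \<open>z\<close>.\<close>

lemma norm_deriv_right_half_plane_le:
  assumes hol: "q holomorphic_on unit_disk" and pos: "\<And>z. z \<in> unit_disk \<Longrightarrow> Re (q z) > 0"
    and z: "z \<in> unit_disk"
  shows "norm (deriv q z) * (1 - (norm z)\<^sup>2) \<le> 2 * Re (q z)"
proof -
  define M where "M = Moebius_function 0 (- z)"
  have M: "M w = (w + z) / (1 + cnj z * w)" for w
    by (simp add: M_def Moebius_function_simple)
  have holM: "M holomorphic_on ball 0 1"
    unfolding M_def using z by (intro Moebius_function_holomorphic) simp
  have ballM: "M w \<in> unit_disk" if "w \<in> unit_disk" for w
    using Moebius_function_norm_lt_1[of "- z" w 0] z that by (simp add: M_def)
  have hol': "(q \<circ> M) holomorphic_on unit_disk"
    using holM hol ballM by (intro holomorphic_on_compose_gen) auto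
  have dM: "(M has_field_derivative of_real (1 - (norm z)\<^sup>2)) (at 0)"
    unfolding M by (auto intro!: derivative_eq_intros
        simp: complex_norm_square[unfolded of_real_power] algebra_simps)
  have "(q has_field_derivative deriv q (M 0)) (at (M 0))"
    using hol z by (intro holomorphic_derivI[of _ "ball 0 1"]) (auto simp: M)
  from DERIV_chain[OF this dM]
  have "deriv (q \<circ> M) 0 = deriv q z * of_real (1 - (norm z)\<^sup>2)"
    by (simp add: DERIV_imp_deriv M)
  moreover have "norm (deriv (q \<circ> M) 0) \<le> 2 * Re ((q \<circ> M) 0)"
    using hol' pos ballM by (intro Schwarz_right_half_plane(2)[of _ 0]) auto
  moreover have "norm (of_real (1 - (norm z)\<^sup>2) :: complex) = 1 - (norm z)\<^sup>2"
    using z unfolding norm_of_real by (simp add: abs_square_le_1 less_imp_le)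
  ultimately show ?thesis
    by (simp add: norm_mult M del: of_real_diff)
qed

section \<open>The radius as the first zero of a quadratic\<close>

text \<open>Rationalising uses
  \<open>(2 - \<alpha> - s) * (2 - \<alpha> + s) = 1 - 2 * \<alpha>\<close>. The new denominator is
  positive, so the exceptional value 1/2 is absorbed into one formula.\<close>

lemma starlike_radius_eq:
  assumes "\<alpha> < 1"
  shows "starlike_radius \<alpha> = 1 / (2 - \<alpha> + sqrt (\<alpha>\<^sup>2 - 2 * \<alpha> + 3))"
proof (cases "\<alpha> = 1 / 2")
  case True
  have "\<alpha>\<^sup>2 - 2 * \<alpha> + 3 = (3 / 2)\<^sup>2" unfolding True by (simp add: power2_eq_square)
  then have "sqrt (\<alpha>\<^sup>2 - 2 * \<alpha> + 3) = 3 / 2" by (simp only: real_sqrt_abs)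
  with True show ?thesis by (simp add: starlike_radius_def)
next
  case False
  define s where "s = sqrt (\<alpha>\<^sup>2 - 2 * \<alpha> + 3)"
  have "\<alpha>\<^sup>2 - 2 * \<alpha> + 3 = (1 - \<alpha>)\<^sup>2 + 2" by (simp add: power2_eq_square algebra_simps)
  then have "s = sqrt ((1 - \<alpha>)\<^sup>2 + 2)" by (simp only: s_def)
  then have s: "s\<^sup>2 = (1 - \<alpha>)\<^sup>2 + 2" "s \<ge> 0" by auto
  have "(2 - \<alpha> - s) * (2 - \<alpha> + s) = (2 - \<alpha>)\<^sup>2 - s\<^sup>2"
    by (simp add: power2_eq_square algebra_simps)
  also have "\<dots> = 1 - 2 * \<alpha>"
    using s(1) by (simp add: power2_eq_square algebra_simps)
  finally have "(2 - \<alpha> - s) * (2 - \<alpha> + s) = 1 - 2 * \<alpha>" .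
  moreover have "2 - \<alpha> + s > 0" using assms s by linarith
  ultimately show ?thesis
    using False by (simp add: starlike_radius_def s_def[symmetric] frac_eq_eq)
qed

lemma starlike_radius:
  assumes "0 \<le> \<alpha>" "\<alpha> < 1"
  shows "0 < starlike_radius \<alpha>" "starlike_radius \<alpha> < 1"
    and "0 \<le> r \<Longrightarrow> r < starlike_radius \<alpha> \<Longrightarrow> 1 - (4 - 2 * \<alpha>) * r + (1 - 2 * \<alpha>) * r\<^sup>2 > 0"
    and "1 - (4 - 2 * \<alpha>) * starlike_radius \<alpha> + (1 - 2 * \<alpha>) * (starlike_radius \<alpha>)\<^sup>2 = 0"
proof -
  define s where "s = sqrt (\<alpha>\<^sup>2 - 2 * \<alpha> + 3)"
  have "\<alpha>\<^sup>2 - 2 * \<alpha> + 3 = (1 - \<alpha>)\<^sup>2 + 2" by (simp add: power2_eq_square algebra_simps)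
  then have "s = sqrt ((1 - \<alpha>)\<^sup>2 + 2)" by (simp only: s_def)
  then have s: "s\<^sup>2 = (1 - \<alpha>)\<^sup>2 + 2" "s \<ge> 0" by auto
  \<comment> \<open>Written as a difference of squares, the quadratic is positive as long as
    \<open>s * r < 1 - (2 - \<alpha>) * r\<close>, and equality there is the equation of the
    radius.\<close>
  have D: "1 - (4 - 2 * \<alpha>) * r + (1 - 2 * \<alpha>) * r\<^sup>2 = (1 - (2 - \<alpha>) * r)\<^sup>2 - s\<^sup>2 * r\<^sup>2" for r
    unfolding s(1) by (simp add: power2_eq_square algebra_simps)
  have R: "starlike_radius \<alpha> = 1 / (2 - \<alpha> + s)"
    using starlike_radius_eq[OF assms(2)] by (simp add: s_def)
  have "s > 0" using s by (cases "s = 0") (auto simp: add_nonneg_eq_0_iff)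
  then have c: "2 - \<alpha> + s > 1" using assms by linarith
  show "0 < starlike_radius \<alpha>" "starlike_radius \<alpha> < 1" using c by (auto simp: R)
  show "1 - (4 - 2 * \<alpha>) * r + (1 - 2 * \<alpha>) * r\<^sup>2 > 0" if "0 \<le> r" "r < starlike_radius \<alpha>"
  proof -
    have "s * r < 1 - (2 - \<alpha>) * r" using that c by (simp add: R field_simps)
    then have "(s * r)\<^sup>2 < (1 - (2 - \<alpha>) * r)\<^sup>2" using s(2) that(1) by (intro power_strict_mono) auto
    then show ?thesis by (simp add: D power_mult_distrib)
  qed
  have "1 - (2 - \<alpha>) * starlike_radius \<alpha> = s * starlike_radius \<alpha>"
    using c by (simp add: R field_simps)
  then show "1 - (4 - 2 * \<alpha>) * starlike_radius \<alpha> + (1 - 2 * \<alpha>) * (starlike_radius \<alpha>)\<^sup>2 = 0"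
    by (simp add: D power_mult_distrib)
qed

section \<open>The logharmonic equation in terms of holomorphic factors\<close>

text \<open>The conjugated factors cancel in both quotients, leaving a relation between the
  logarithmic derivatives of \<open>v\<close> and \<open>u\<close>.\<close>

lemma logharmonic_equation_iff:
  assumes "open S" "z \<in> S" "\<And>w. w \<in> S \<Longrightarrow> F w = u w * cnj (v w)"
    and "(u has_field_derivative u') (at z)" "(v has_field_derivative v') (at z)"
    and nz: "u z \<noteq> 0" "v z \<noteq> 0"
  shows "cnj (wirtinger_bar F z) / cnj (F z) = a z * (wirtinger F z / F z) \<longleftrightarrow>
    v' / v z = a z * (u' / u z)"
proof -
  have "wirtinger F z = u' * cnj (v z)"
    using assms(1-5) by (rule wirtinger_mult_cnj)
  moreover have "wirtinger_bar F z = u z * cnj v'"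
    using assms(1-5) by (rule wirtinger_mult_cnj)
  ultimately show ?thesis
    using nz by (simp add: assms(3)[OF assms(2)])
qed

lemma has_field_derivative_exp_holomorphic:
  assumes "l holomorphic_on S" "open S" "z \<in> S"
  shows "((\<lambda>z. exp (l z)) has_field_derivative deriv l z * exp (l z)) (at z)"
    and "((\<lambda>z. z * exp (l z)) has_field_derivative (1 + z * deriv l z) * exp (l z)) (at z)"
  using holomorphic_derivI[OF assms, of UNIV]
  by (auto intro!: derivative_eq_intros simp: algebra_simps)

lemma logharmonic_exp_iff:
  assumes hol: "m1 holomorphic_on unit_disk" "m2 holomorphic_on unit_disk"
    and R: "\<And>z. z \<in> unit_disk \<Longrightarrow> R z = exp (m1 z) * cnj (exp (m2 z))"
  shows "logharmonic a R \<longleftrightarrow> (\<forall>z\<in>unit_disk. deriv m2 z = a z * deriv m1 z)"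
proof -
  note d = has_field_derivative_exp_holomorphic(1)[OF hol(1) open_ball]
    has_field_derivative_exp_holomorphic(1)[OF hol(2) open_ball]
  have "R differentiable (at z)" if "z \<in> unit_disk" for z
    using open_ball that R d[OF that] by (rule wirtinger_mult_cnj)
  moreover have "cnj (wirtinger_bar R z) / cnj (R z) = a z * (wirtinger R z / R z) \<longleftrightarrow>
      deriv m2 z = a z * deriv m1 z" if "z \<in> unit_disk" for z
    using logharmonic_equation_iff[OF open_ball that R d[OF that], of a] by simp
  moreover have "R z \<noteq> 0" if "z \<in> unit_disk" for z
    using R[OF that] by simp
  ultimately show ?thesis
    unfolding logharmonic_def by blast
qed

text \<open>Here \<open>u'/u = (1 + z * deriv l1 z) / z\<close>, and the equation is multiplied by
  \<open>z\<close>. The origin is excluded because \<open>f\<close> vanishes there and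
  \<open>logharmonic\<close> then imposes no equation.\<close>

lemma logharmonic_mult_exp:
  assumes hol: "l1 holomorphic_on unit_disk" "l2 holomorphic_on unit_disk"
    and f: "\<And>z. z \<in> unit_disk \<Longrightarrow> f z = z * exp (l1 z) * cnj (exp (l2 z))"
  shows "logharmonic a f \<longleftrightarrow>
      (\<forall>z\<in>unit_disk - {0}. z * deriv l2 z = a z * (1 + z * deriv l1 z))"
    and "z \<in> unit_disk - {0} \<Longrightarrow>
      starlike_quotient f z = 1 + z * deriv l1 z - cnj (z * deriv l2 z)"
proof -
  note d = has_field_derivative_exp_holomorphic(2)[OF hol(1) open_ball]
    has_field_derivative_exp_holomorphic(1)[OF hol(2) open_ball]
  have "f differentiable (at z)" if "z \<in> unit_disk" for z
    using open_ball that f d[OF that] by (rule wirtinger_mult_cnj)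
  moreover have "cnj (wirtinger_bar f z) / cnj (f z) = a z * (wirtinger f z / f z) \<longleftrightarrow>
      z * deriv l2 z = a z * (1 + z * deriv l1 z)" if z: "z \<in> unit_disk - {0}" for z
  proof -
    have "cnj (wirtinger_bar f z) / cnj (f z) = a z * (wirtinger f z / f z) \<longleftrightarrow>
        deriv l2 z = a z * ((1 + z * deriv l1 z) / z)"
      using logharmonic_equation_iff[OF open_ball[of 0 1] _ f d, where a = a and z = z] z by simp
    also have "\<dots> \<longleftrightarrow> z * deriv l2 z = a z * (1 + z * deriv l1 z)"
      using z by (simp add: nonzero_eq_divide_eq mult.commute)
    finally show ?thesis .
  qed
  moreover have "f z \<noteq> 0 \<longleftrightarrow> z \<noteq> 0" if "z \<in> unit_disk" for z
    using f[OF that] by simp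
  ultimately show "logharmonic a f \<longleftrightarrow>
      (\<forall>z\<in>unit_disk - {0}. z * deriv l2 z = a z * (1 + z * deriv l1 z))"
    unfolding logharmonic_def by blast
  show "starlike_quotient f z = 1 + z * deriv l1 z - cnj (z * deriv l2 z)" if "z \<in> unit_disk - {0}"
    using starlike_quotient_mult_cnj[OF open_ball[of 0 1] _ f d, of z] that by simp
qed

section \<open>Starlikeness up to the radius\<close>

text \<open>All four holomorphic factors are zero-free on the disk and so have logarithms there.
  Adding those of \<open>f\<close> and \<open>R\<close> brings \<open>F\<close> into the form
  treated by \<open>starlike_logharmonic_exp\<close>.\<close>

lemma CST_Lh_maps_disk_onto_starlike:
  assumes \<alpha>: "0 \<le> \<alpha>" "\<alpha> < 1" and F: "F \<in> CST_Lh \<alpha>"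
    and \<rho>: "0 < \<rho>" "\<rho> \<le> starlike_radius \<alpha>"
  shows "maps_disk_onto_starlike F \<rho>"
proof -
  obtain a f R where a: "a \<in> dilatations" and f: "f \<in> ST_Lh \<alpha>" "logharmonic a f"
    and R: "R \<in> P_Lh" "logharmonic a R" and FfR: "\<And>z. z \<in> unit_disk \<Longrightarrow> F z = f z * R z"
    using F by (auto simp: CST_Lh_def CST_Lh_wrt_def)
  obtain h g where hg: "h holomorphic_on unit_disk" "g holomorphic_on unit_disk"
      "\<And>z. z \<in> unit_disk \<Longrightarrow> h z \<noteq> 0" "\<And>z. z \<in> unit_disk \<Longrightarrow> g z \<noteq> 0"
      "\<And>z. z \<in> unit_disk \<Longrightarrow> f z = z * h z * cnj (g z)"
    and fpos: "\<And>z. z \<in> unit_disk - {0} \<Longrightarrow> Re (starlike_quotient f z) > \<alpha>"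
    using f(1) by (auto simp: ST_Lh_def)
  obtain H G where HG: "H holomorphic_on unit_disk" "G holomorphic_on unit_disk" "H 0 = 1" "G 0 = 1"
      "\<And>z. z \<in> unit_disk \<Longrightarrow> R z = H z * cnj (G z)"
    and Rpos: "\<And>z. z \<in> unit_disk \<Longrightarrow> Re (R z) > 0"
    using R(1) by (auto simp: P_Lh_def)
  have HGnz: "H z \<noteq> 0" "G z \<noteq> 0" if "z \<in> unit_disk" for z
    using Rpos[OF that] HG(5)[OF that] by auto
  have contr: "contractible unit_disk"
    by (simp add: convex_imp_contractible)
  obtain lh where lh: "lh holomorphic_on unit_disk" "\<And>z. z \<in> unit_disk \<Longrightarrow> h z = exp (lh z)"
    using contractible_imp_holomorphic_log[OF hg(1) contr] hg(3) by blast
  obtain lg where lg: "lg holomorphic_on unit_disk" "\<And>z. z \<in> unit_disk \<Longrightarrow> g z = exp (lg z)"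
    using contractible_imp_holomorphic_log[OF hg(2) contr] hg(4) by blast
  obtain lH where lH: "lH holomorphic_on unit_disk" "\<And>z. z \<in> unit_disk \<Longrightarrow> H z = exp (lH z)"
    using contractible_imp_holomorphic_log[OF HG(1) contr] HGnz by blast
  obtain lG where lG: "lG holomorphic_on unit_disk" "\<And>z. z \<in> unit_disk \<Longrightarrow> G z = exp (lG z)"
    using contractible_imp_holomorphic_log[OF HG(2) contr] HGnz by blast
  have f_eq: "f z = z * exp (lh z) * cnj (exp (lg z))" if "z \<in> unit_disk" for z
    using hg(5) lh(2) lg(2) that by simp
  have R_eq: "R z = exp (lH z) * cnj (exp (lG z))" if "z \<in> unit_disk" for z
    using HG(5) lH(2) lG(2) that by simp
  define l1 l2 where "l1 z = lh z + lH z" and "l2 z = lg z + lG z" for z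
  have hol12: "l1 holomorphic_on unit_disk" "l2 holomorphic_on unit_disk"
    unfolding l1_def l2_def using lh lg lH lG by (auto intro!: holomorphic_intros)
  have F_eq: "F z = z * exp (l1 z) * cnj (exp (l2 z))" if "z \<in> unit_disk" for z
    using FfR[OF that] f_eq[OF that] R_eq[OF that] by (simp add: l1_def l2_def exp_add)
  have diff: "l field_differentiable (at z)" if "l holomorphic_on unit_disk" "z \<in> unit_disk" for l z
    using that holomorphic_on_imp_differentiable_at by blast
  have d12: "deriv l1 z = deriv lh z + deriv lH z" "deriv l2 z = deriv lg z + deriv lG z"
    if "z \<in> unit_disk" for z
    unfolding l1_def l2_def using that lh lg lH lG by (auto intro!: deriv_add diff)
  \<comment> \<open>In logarithmic form the equations of \<open>f\<close> and \<open>R\<close> are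
    linear with the same coefficient \<open>a\<close>, so they add up.\<close>
  have eq: "z * deriv l2 z = a z * (1 + z * deriv l1 z)" if z: "z \<in> unit_disk - {0}" for z
  proof -
    have "z * deriv lg z = a z * (1 + z * deriv lh z)"
      using f(2) logharmonic_mult_exp(1)[OF lh(1) lg(1) f_eq] z by blast
    moreover have "deriv lG z = a z * deriv lH z"
      using R(2) logharmonic_exp_iff[OF lH(1) lG(1) R_eq] z by blast
    ultimately show ?thesis using d12[of z] z by (simp add: algebra_simps)
  qed
  \<comment> \<open>Removing the conjugation from the quotient of \<open>f\<close> keeps its real
    part and makes it holomorphic, with value 1 at the origin.\<close>
  define p where "p z = 1 + z * deriv lh z - z * deriv lg z" for z
  have holp: "p holomorphic_on unit_disk"
    unfolding p_def using lh lg by (auto intro!: holomorphic_intros)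
  have ppos: "Re (p z) > \<alpha>" if "z \<in> unit_disk" for z
  proof (cases "z = 0")
    case False
    then show ?thesis
      using fpos[of z] logharmonic_mult_exp(2)[OF lh(1) lg(1) f_eq, of z] that by (simp add: p_def)
  qed (use \<alpha> in \<open>simp add: p_def\<close>)
  \<comment> \<open>This is \<open>H / G\<close>. Since \<open>R = q * |G|^2\<close>, positivity of
    \<open>Re R\<close> passes to \<open>q\<close>.\<close>
  define q where "q z = exp (lH z - lG z)" for z
  have holq: "q holomorphic_on unit_disk"
    unfolding q_def using lH lG by (auto intro!: holomorphic_intros)
  have qpos: "Re (q z) > 0" if "z \<in> unit_disk" for z
  proof -
    have "R z = q z * (G z * cnj (G z))"
      using HG(5)[OF that] lH(2)[OF that] lG(2)[OF that] by (simp add: q_def exp_diff)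
    then have "Re (R z) = Re (q z) * (norm (G z))\<^sup>2"
      by (simp flip: complex_norm_square)
    then show ?thesis using Rpos[OF that] by (simp add: zero_less_mult_iff)
  qed
  have dq: "deriv q z = (deriv lH z - deriv lG z) * q z" if "z \<in> unit_disk" for z
  proof -
    have "(lH has_field_derivative deriv lH z) (at z)" "(lG has_field_derivative deriv lG z) (at z)"
      using lH(1) lG(1) that by (auto intro: holomorphic_derivI[of _ "ball 0 1"])
    then show ?thesis
      unfolding q_def by (intro DERIV_imp_deriv) (auto intro!: derivative_eq_intros)
  qed
  have pos: "Re (1 + z * deriv l1 z - z * deriv l2 z) > 0" if "norm z < starlike_radius \<alpha>" for z
  proof -
    define r where "r = norm z"
    have r: "0 \<le> r" "r < 1" "r < starlike_radius \<alpha>"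
      using that starlike_radius(2)[OF \<alpha>] by (auto simp: r_def)
    have z: "z \<in> unit_disk" using r by (simp add: r_def)
    have r2: "r\<^sup>2 < 1" using r by (simp add: power_less_one_iff)
    \<comment> \<open>\<open>D\<close> is the logarithmic derivative of \<open>q\<close>. The
      derivative estimate together with \<open>Re q \<le> |q|\<close> gives
      \<open>|D| \<le> 2 / (1 - r^2)\<close>.\<close>
    define D where "D = deriv lH z - deriv lG z"
    have "norm D * norm (q z) * (1 - r\<^sup>2) \<le> 2 * Re (q z)"
      using norm_deriv_right_half_plane_le[OF holq qpos z] dq[OF z] by (simp add: D_def r_def norm_mult)
    also have "\<dots> \<le> 2 * norm (q z)" using complex_Re_le_cmod[of "q z"] by simp
    finally have "norm D * (1 - r\<^sup>2) \<le> 2"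
      using qpos[OF z] by (cases "q z = 0") (auto simp: mult.commute mult.left_commute)
    then have "norm D \<le> 2 / (1 - r\<^sup>2)" using r2 by (simp add: pos_le_divide_eq)
    then have "norm (z * D) \<le> r * (2 / (1 - r\<^sup>2))"
      unfolding norm_mult r_def[symmetric] using r by (intro mult_left_mono)
    then have "Re (z * D) \<ge> - (2 * r / (1 - r\<^sup>2))"
      using abs_Re_le_cmod[of "z * D"] by simp
    moreover have "Re (p z) \<ge> (1 - (1 - 2 * \<alpha>) * r) / (1 + r)"
      unfolding r_def by (rule Re_ge_half_plane_function[OF holp ppos _ z]) (auto simp: p_def)
    moreover have "(1 - (1 - 2 * \<alpha>) * r) / (1 + r) - 2 * r / (1 - r\<^sup>2)
        = (1 - (4 - 2 * \<alpha>) * r + (1 - 2 * \<alpha>) * r\<^sup>2) / (1 - r\<^sup>2)"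
    proof -
      have "1 - r\<^sup>2 = (1 - r) * (1 + r)" by (simp add: power2_eq_square algebra_simps)
      then show ?thesis using r by (simp add: divide_simps) (simp add: power2_eq_square algebra_simps)
    qed
    moreover have "\<dots> > 0"
      using starlike_radius(3)[OF \<alpha> r(1,3)] r2 by simp
    moreover have "1 + z * deriv l1 z - z * deriv l2 z = p z + z * D"
      using d12[OF z] by (simp add: p_def D_def algebra_simps)
    ultimately show ?thesis by simp
  qed
  have sub: "z \<in> unit_disk" "norm z < starlike_radius \<alpha>" if "z \<in> ball 0 \<rho>" for z
    using that \<rho> starlike_radius(2)[OF \<alpha>] by auto
  have hol\<rho>: "l1 holomorphic_on ball 0 \<rho>" "l2 holomorphic_on ball 0 \<rho>"
    using hol12 sub by (auto intro: holomorphic_on_subset)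
  have "F z = z * exp (l1 z) * cnj (exp (l2 z))" if "z \<in> ball 0 \<rho>" for z
    using F_eq sub that by blast
  moreover have "z * deriv l2 z = a z * (1 + z * deriv l1 z)" "norm (a z) < 1"
      "Re (1 + z * deriv l1 z - z * deriv l2 z) > 0" if "z \<in> ball 0 \<rho> - {0}" for z
    using that sub[of z] eq[of z] pos[of z] a by (auto simp: dilatations_def)
  ultimately have "inj_on F (ball 0 \<rho>)" "starlike_wrt_origin (F ` ball 0 \<rho>)"
    using starlike_logharmonic_exp[OF \<rho>(1) hol\<rho>, of F a] by blast+
  moreover have "Re (starlike_quotient F z) > 0" if "z \<in> ball 0 \<rho> - {0}" for z
    using logharmonic_mult_exp(2)[OF hol12 F_eq, of z] pos[of z] sub[of z] that by simp
  ultimately show ?thesis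
    by (simp add: maps_disk_onto_starlike_def)
qed

section \<open>Extremal mappings for a prescribed dilatation\<close>

lemma Re_Cayley_pos:
  assumes "norm z < 1"
  shows "Re ((1 + z) / (1 - z)) > 0"
proof -
  have "(1 + z) / (1 - z) = (1 + z) * cnj (1 - z) / of_real ((norm (1 - z))\<^sup>2)"
    using complex_div_cnj by blast
  then have "Re ((1 + z) / (1 - z)) = Re ((1 + z) * cnj (1 - z)) / (norm (1 - z))\<^sup>2"
    by (simp del: of_real_power)
  also have "Re ((1 + z) * cnj (1 - z)) = 1 - (norm z)\<^sup>2"
    unfolding cmod_power2 by (simp add: algebra_simps power2_eq_square)
  finally have "Re ((1 + z) / (1 - z)) = (1 - (norm z)\<^sup>2) / (norm (1 - z))\<^sup>2" .
  moreover have "(norm z)\<^sup>2 < 1" "1 - z \<noteq> 0"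
    using assms by (auto simp: power_less_one_iff)
  ultimately show ?thesis by simp
qed

text \<open>The normalisation at 0 later provides \<open>g 0 = 1\<close> and
  \<open>H 0 = G 0 = 1\<close>.\<close>

lemma holomorphic_primitive_unit_disk:
  assumes "k holomorphic_on unit_disk"
  obtains l where "l holomorphic_on unit_disk" "l 0 = 0"
    "\<And>z. z \<in> unit_disk \<Longrightarrow> (l has_field_derivative k z) (at z)"
proof -
  obtain l where l: "\<And>z. z \<in> unit_disk \<Longrightarrow> (l has_field_derivative k z) (at z within unit_disk)"
    using holomorphic_convex_primitive'[OF convex_ball open_ball assms] by blast
  then have *: "((\<lambda>z. l z - l 0) has_field_derivative k z) (at z)" if "z \<in> unit_disk" for z
    using l[OF that] that by (auto intro!: derivative_eq_intros simp: at_within_open[OF that])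
  then have "(\<lambda>z. l z - l 0) holomorphic_on unit_disk"
    unfolding holomorphic_on_open[OF open_ball] by blast
  then show thesis
    using * by (intro that[of "\<lambda>z. l z - l 0"]) auto
qed

text \<open>Prescribing \<open>p\<close> and \<open>q\<close> fixes the differences
  \<open>l1' - l2'\<close> and \<open>m1' - m2'\<close>. Combined with the logharmonic equations for
  \<open>a\<close>, this gives linear systems whose solutions are integrated.\<close>

lemma CST_Lh_extremal:
  assumes \<alpha>: "0 \<le> \<alpha>" "\<alpha> < 1" and a: "a \<in> dilatations" "a 0 = 0"
  obtains F where "F \<in> CST_Lh_wrt \<alpha> a"
    "Re (starlike_quotient F (- of_real (starlike_radius \<alpha>))) = 0"
proof -
  \<comment> \<open>Chosen so that \<open>1 + \<beta> * z / (1 - z) = (1 + (1 - 2 * \<alpha>) * z) /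
    (1 - z)\<close>, the extremal \<open>p\<close>.\<close>
  define \<beta> where "\<beta> = 2 * complex_of_real (1 - \<alpha>)"
  have hola: "a holomorphic_on unit_disk" and a1: "\<And>z. z \<in> unit_disk \<Longrightarrow> norm (a z) < 1"
    using a(1) by (auto simp: dilatations_def)
  obtain b where b: "b holomorphic_on unit_disk" "\<And>z. z \<in> unit_disk \<Longrightarrow> a z = z * b z"
    using Schwarz3[OF hola a(2)] by (metis mem_ball_0)
  have nz: "1 - z \<noteq> 0" "1 + z \<noteq> 0" "1 - a z \<noteq> 0" "1 - z \<notin> \<real>\<^sub>\<le>\<^sub>0" "1 + z \<notin> \<real>\<^sub>\<le>\<^sub>0" "Re z < 1" "Re z > - 1"
    if "z \<in> unit_disk" for z
  proof -
    have "\<bar>Re z\<bar> < 1" using that abs_Re_le_cmod[of z] by simp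
    then show "1 - z \<noteq> 0" "1 + z \<noteq> 0" "1 - z \<notin> \<real>\<^sub>\<le>\<^sub>0" "1 + z \<notin> \<real>\<^sub>\<le>\<^sub>0" "Re z < 1" "Re z > - 1"
      by (auto simp: complex_eq_iff complex_nonpos_Reals_iff)
    show "1 - a z \<noteq> 0" using a1[OF that] by auto
  qed
  \<comment> \<open>Substituting \<open>z * l1' = z * l2' + \<beta> * z / (1 - z)\<close> into the
    equation of \<open>f\<close> gives
    \<open>(1 - a) * z * l2' = a * (1 + \<beta> * z / (1 - z))\<close>. Writing
    \<open>a = z * b\<close>, possible as \<open>a 0 = 0\<close>, cancels \<open>z\<close> and makes
    \<open>k = l2'\<close> holomorphic at 0.\<close>
  define k where "k z = b z * (1 + \<beta> * z / (1 - z)) / (1 - a z)" for z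
  have "k holomorphic_on unit_disk"
    unfolding k_def using b hola nz by (intro holomorphic_intros) auto
  then obtain l2 where l2: "l2 holomorphic_on unit_disk" "l2 0 = 0"
      "\<And>z. z \<in> unit_disk \<Longrightarrow> (l2 has_field_derivative k z) (at z)"
    using holomorphic_primitive_unit_disk by blast
  define l1 where "l1 z = l2 z - \<beta> * Ln (1 - z)" for z
  have holl1: "l1 holomorphic_on unit_disk"
    unfolding l1_def using l2 nz by (intro holomorphic_intros) auto
  have dl1: "(l1 has_field_derivative k z + \<beta> / (1 - z)) (at z)" if "z \<in> unit_disk" for z
    unfolding l1_def using l2(3)[OF that] nz[OF that]
    by (auto intro!: derivative_eq_intros simp: field_simps)
  \<comment> \<open>The same elimination for \<open>R\<close>: the logarithmic derivative of
    \<open>(1 + z) / (1 - z)\<close> is \<open>2 / ((1 - z) * (1 + z))\<close>, and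
    \<open>(1 - a) * m2' = a * (m1' - m2')\<close>.\<close>
  define j where "j z = a z * (2 / ((1 - z) * (1 + z))) / (1 - a z)" for z
  have "j holomorphic_on unit_disk"
    unfolding j_def using hola nz by (intro holomorphic_intros) auto
  then obtain m2 where m2: "m2 holomorphic_on unit_disk" "m2 0 = 0"
      "\<And>z. z \<in> unit_disk \<Longrightarrow> (m2 has_field_derivative j z) (at z)"
    using holomorphic_primitive_unit_disk by blast
  define m1 where "m1 z = m2 z + Ln (1 + z) - Ln (1 - z)" for z
  have holm1: "m1 holomorphic_on unit_disk"
    unfolding m1_def using m2 nz by (intro holomorphic_intros) auto
  have dm1: "(m1 has_field_derivative j z + 2 / ((1 - z) * (1 + z))) (at z)" if "z \<in> unit_disk" for z
    unfolding m1_def using m2(3)[OF that] nz[OF that]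
    by (auto intro!: derivative_eq_intros simp: divide_simps) (simp add: algebra_simps)
  note D = DERIV_imp_deriv[OF dl1] DERIV_imp_deriv[OF l2(3)] DERIV_imp_deriv[OF dm1]
    DERIV_imp_deriv[OF m2(3)]
  define f R where "f z = z * exp (l1 z) * cnj (exp (l2 z))"
    and "R z = exp (m1 z) * cnj (exp (m2 z))" for z
  have feq: "z * deriv l2 z = a z * (1 + z * deriv l1 z)" if z: "z \<in> unit_disk" for z
  proof -
    have "(1 - a z) * (z * k z) = a z * (1 + \<beta> * z / (1 - z))"
      using nz[OF z] b(2)[OF z] by (simp add: k_def)
    moreover have "a z * (1 + z * deriv l1 z) - z * deriv l2 z
        = a z * (1 + \<beta> * z / (1 - z)) - (1 - a z) * (z * k z)"
      using D z by (simp add: algebra_simps)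
    ultimately show ?thesis by simp
  qed
  have Req: "deriv m2 z = a z * deriv m1 z" if z: "z \<in> unit_disk" for z
  proof -
    have "(1 - a z) * j z = a z * (2 / ((1 - z) * (1 + z)))"
      using nz[OF z] by (simp add: j_def)
    moreover have "a z * deriv m1 z - deriv m2 z
        = a z * (2 / ((1 - z) * (1 + z))) - (1 - a z) * j z"
      using D z by (simp add: algebra_simps)
    ultimately show ?thesis by simp
  qed
  have logf: "logharmonic a f"
    using logharmonic_mult_exp(1)[OF holl1 l2(1) f_def] feq by blast
  have logR: "logharmonic a R"
    using logharmonic_exp_iff[OF holm1 m2(1) R_def] Req by blast
  have fpos: "Re (1 + z * deriv l1 z - z * deriv l2 z) > \<alpha>" if z: "z \<in> unit_disk" for z
  proof -
    have "1 + z * deriv l1 z - z * deriv l2 z = of_real \<alpha> + of_real (1 - \<alpha>) * ((1 + z) / (1 - z))"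
      using D z nz[OF z] by (simp add: \<beta>_def divide_simps) (simp add: algebra_simps)
    moreover have "(1 - \<alpha>) * Re ((1 + z) / (1 - z)) > 0"
      using Re_Cayley_pos[of z] z \<alpha> by (intro mult_pos_pos) auto
    ultimately show ?thesis by (simp del: of_real_diff times_divide_eq_right)
  qed
  \<comment> \<open>The univalence criterion applies on the whole unit disk, because the quotient of
    \<open>f\<close> has real part above \<alpha>, hence positive.\<close>
  have "inj_on f unit_disk"
  proof (rule starlike_logharmonic_exp(1)[OF _ holl1 l2(1) f_def feq a1])
    fix z :: complex assume "z \<in> unit_disk - {0}"
    then show "Re (1 + z * deriv l1 z - z * deriv l2 z) > 0"
      using fpos[of z] \<alpha> by simp
  qed auto
  moreover have "Re (starlike_quotient f z) > \<alpha>" if "z \<in> unit_disk - {0}" for z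
    using logharmonic_mult_exp(2)[OF holl1 l2(1) f_def that] fpos[of z] that by simp
  moreover have "\<exists>h g. h holomorphic_on unit_disk \<and> g holomorphic_on unit_disk \<and>
      (\<forall>z\<in>unit_disk. h z \<noteq> 0 \<and> g z \<noteq> 0) \<and> g 0 = 1 \<and> (\<forall>z\<in>unit_disk. f z = z * h z * cnj (g z))"
    by (rule exI[of _ "\<lambda>z. exp (l1 z)"], rule exI[of _ "\<lambda>z. exp (l2 z)"])
      (use holl1 l2(1,2) in \<open>auto simp: f_def intro!: holomorphic_intros\<close>)
  ultimately have fST: "f \<in> ST_Lh \<alpha>"
    using logf a(1) unfolding ST_Lh_def by blast
  have "Re (R z) > 0" if z: "z \<in> unit_disk" for z
  proof -
    have "R z = (1 + z) / (1 - z) * (exp (m2 z) * cnj (exp (m2 z)))"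
      using nz[OF z] by (simp add: R_def m1_def exp_add exp_diff)
    then have "Re (R z) = Re ((1 + z) / (1 - z)) * (norm (exp (m2 z)))\<^sup>2"
      by (simp del: of_real_power times_divide_eq_left flip: complex_norm_square)
    then show ?thesis using Re_Cayley_pos[of z] z by simp
  qed
  moreover have m1: "m1 0 = 0" using m2(2) by (simp add: m1_def)
  moreover have "\<exists>H G. H holomorphic_on unit_disk \<and> G holomorphic_on unit_disk \<and>
      H 0 = 1 \<and> G 0 = 1 \<and> (\<forall>z\<in>unit_disk. R z = H z * cnj (G z))"
    by (rule exI[of _ "\<lambda>z. exp (m1 z)"], rule exI[of _ "\<lambda>z. exp (m2 z)"])
      (use holm1 m1 m2(1,2) in \<open>auto simp: R_def intro!: holomorphic_intros\<close>)
  ultimately have RP: "R \<in> P_Lh"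
    using logR a(1) unfolding P_Lh_def by blast
  define F where "F z = f z * R z" for z
  have FCST: "F \<in> CST_Lh_wrt \<alpha> a"
    using fST RP logf logR by (auto simp: CST_Lh_wrt_def F_def)
  \<comment> \<open>At the negative point of modulus \<rho> both estimates are attained at once:
    \<open>p\<close> takes its least possible real part and \<open>z * q' / q\<close> equals
    \<open>- 2 * \<rho> / (1 - \<rho>^2)\<close>.\<close>
  define \<rho> z where "\<rho> = starlike_radius \<alpha>" and "z = - complex_of_real \<rho>"
  have \<rho>: "0 < \<rho>" "\<rho> < 1" using starlike_radius(1,2)[OF \<alpha>] by (auto simp: \<rho>_def)
  have z: "z \<in> unit_disk - {0}" "z \<in> unit_disk" using \<rho> by (auto simp: z_def)
  have hol: "(\<lambda>z. l1 z + m1 z) holomorphic_on unit_disk" "(\<lambda>z. l2 z + m2 z) holomorphic_on unit_disk"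
    using holl1 l2(1) holm1 m2(1) by (auto intro!: holomorphic_intros)
  have "F z = z * exp (l1 z + m1 z) * cnj (exp (l2 z + m2 z))" for z
    by (simp add: F_def f_def R_def exp_add)
  from logharmonic_mult_exp(2)[OF hol this z(1)]
  have "Re (starlike_quotient F z)
      = Re (1 + z * (deriv (\<lambda>z. l1 z + m1 z) z - deriv (\<lambda>z. l2 z + m2 z) z))"
    by (simp add: right_diff_distrib)
  also have "deriv (\<lambda>z. l1 z + m1 z) z - deriv (\<lambda>z. l2 z + m2 z) z
      = \<beta> / (1 - z) + 2 / ((1 - z) * (1 + z))"
    using DERIV_imp_deriv[OF DERIV_add[OF dl1 dm1]] DERIV_imp_deriv[OF DERIV_add[OF l2(3) m2(3)]] z
    by simp
  also have "1 + z * \<dots> = of_real (1 - \<rho> * (2 * (1 - \<alpha>) / (1 + \<rho>) + 2 / ((1 + \<rho>) * (1 - \<rho>))))"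
    by (simp add: \<beta>_def z_def)
  also have "Re \<dots> = (1 - (4 - 2 * \<alpha>) * \<rho> + (1 - 2 * \<alpha>) * \<rho>\<^sup>2) / ((1 + \<rho>) * (1 - \<rho>))"
    using \<rho> by (simp add: divide_simps) (simp add: power2_eq_square algebra_simps)
  also have "\<dots> = 0"
    unfolding \<rho>_def starlike_radius(4)[OF \<alpha>] by simp
  finally show thesis
    using that[OF FCST] by (simp add: z_def \<rho>_def)
qed

theorem theorem2:
  fixes \<alpha> :: real
  assumes "0 \<le> \<alpha>" and "\<alpha> < 1"
  shows "(\<forall>F\<in>CST_Lh \<alpha>. \<forall>\<rho>. 0 < \<rho> \<and> \<rho> \<le> starlike_radius \<alpha> \<longrightarrow> maps_disk_onto_starlike F \<rho>) \<and>
    (\<forall>a\<in>dilatations. a 0 = 0 \<longrightarrow>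
       (\<forall>\<rho>'>starlike_radius \<alpha>.
          \<not> (\<forall>F\<in>CST_Lh_wrt \<alpha> a. \<forall>\<rho>. 0 < \<rho> \<and> \<rho> \<le> \<rho>' \<longrightarrow> maps_disk_onto_starlike F \<rho>)))"
proof (intro conjI ballI allI impI notI)
  fix F \<rho> assume "F \<in> CST_Lh \<alpha>" "0 < \<rho> \<and> \<rho> \<le> starlike_radius \<alpha>"
  then show "maps_disk_onto_starlike F \<rho>"
    using CST_Lh_maps_disk_onto_starlike[OF assms] by blast
next
  fix a \<rho>' assume a: "a \<in> dilatations" "a 0 = 0" and \<rho>': "starlike_radius \<alpha> < \<rho>'"
    and all: "\<forall>F\<in>CST_Lh_wrt \<alpha> a. \<forall>\<rho>. 0 < \<rho> \<and> \<rho> \<le> \<rho>' \<longrightarrow> maps_disk_onto_starlike F \<rho>"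
  obtain F where F: "F \<in> CST_Lh_wrt \<alpha> a"
    "Re (starlike_quotient F (- of_real (starlike_radius \<alpha>))) = 0"
    using CST_Lh_extremal[OF assms a] .
  have "0 < starlike_radius \<alpha>" using starlike_radius(1)[OF assms] .
  \<comment> \<open>A larger radius puts the zero of the real part of the quotient inside the
    punctured disk, where strict positivity is demanded.\<close>
  then have "- complex_of_real (starlike_radius \<alpha>) \<in> ball 0 \<rho>' - {0}" "0 < \<rho>'"
    using \<rho>' by auto
  then have "Re (starlike_quotient F (- of_real (starlike_radius \<alpha>))) > 0"
    using all F(1) unfolding maps_disk_onto_starlike_def by blast
  with F(2) show False by simp
qed

end
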